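(* Let $G$ be a connected graph of order $n$ with $n\geq 6$, and let $\ell$ be an integer with $1\leq \ell\leq \lfloor\frac{n}{2}\rfloor$. If $\overline{\lambda}_n(G)\leq \ell$, then $$ e(G)\leq \begin{cases} \binom{n-1}{2}+\ell, & \text{if } 1\leq \ell\leq \lfloor\frac{n-4}{2}\rfloor;\\ \binom{n-1}{2}+n-2, & \text{if } \ell=\lfloor\frac{n-2}{2}\rfloor \text{ and } n \text{ is even};\\ \binom{n-1}{2}+\frac{n-3}{2}, & \text{if } \ell=\lfloor\frac{n-2}{2}\rfloor \text{ and } n \text{ is odd};\\ \binom{n}{2}, & \text{if } \ell=\lfloor\frac{n}{2}\rfloor, \end{cases} $$ with equality if and only if: $G\in\mathcal{G}_n$ for $1\leq \ell\leq \lfloor\frac{n-4}{2}\rfloor$; $G=K_n\setminus e$ with $e\in E(K_n)$ for $\ell=\lfloor\frac{n-2}{2}\rfloor$ and $n$ even; $G=K_n\setminus M$ with $M\subseteq E(K_n)$ and $|M|=\frac{n+1}{2}$ for $\ell=\lfloor\frac{n-2}{2}\rfloor$ and $n$ odd; $G=K_n$ for $\ell=\lfloor\frac{n}{2}\rfloor$.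
   Context: All graphs are finite, simple and undirected; $e(G)$ is the number of edges of $G$. For a graph $G$ and $S\subseteq V(G)$ with $|S|\geq 2$, a tree connecting $S$ is a subgraph of $G$ that is a tree whose vertex set contains $S$. Let $\lambda(S)$ be the maximum number of pairwise edge-disjoint trees connecting $S$ in $G$. For $2\leq k\leq |V(G)|$, $\overline{\lambda}_k(G)=\max\{\lambda(S): S\subseteq V(G),\ |S|=k\}$ (so for $k=n=|V(G)|$ it is the maximum number of edge-disjoint spanning trees of $G$). $K_n\setminus M$ (resp. $K_n\setminus e$) is the graph obtained from the complete graph $K_n$ by deleting the edges in $M$ (resp. the edge $e$). For the given $\ell$, $\mathcal{G}_n$ is the class of graphs obtained from a complete graph $K_{n-1}$ by adding a new vertex $v$ and joining $v$ to $\ell$ vertices of $K_{n-1}$. Equalities of graphs are up to isomorphism. *)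

theory Defs
  imports Complex_Main
begin

type_synonym 'a ugraph = "'a set \<times> 'a set set"

abbreviation verts :: "'a ugraph \<Rightarrow> 'a set" where
  "verts G \<equiv> fst G"

abbreviation edges :: "'a ugraph \<Rightarrow> 'a set set" where
  "edges G \<equiv> snd G"

definition simple_graph :: "'a ugraph \<Rightarrow> bool" where
  "simple_graph G \<longleftrightarrow>
     finite (verts G) \<and> (\<forall>e\<in>edges G. e \<subseteq> verts G \<and> card e = 2)"

definition subgraph :: "'a ugraph \<Rightarrow> 'a ugraph \<Rightarrow> bool" where
  "subgraph H G \<longleftrightarrow>
     simple_graph H \<and> verts H \<subseteq> verts G \<and> edges H \<subseteq> edges G"

definition adj_rel :: "'a ugraph \<Rightarrow> ('a \<times> 'a) set" where
  "adj_rel G = {(u, v). {u, v} \<in> edges G}"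

definition connected_graph :: "'a ugraph \<Rightarrow> bool" where
  "connected_graph G \<longleftrightarrow>
     verts G \<noteq> {} \<and> (\<forall>u\<in>verts G. \<forall>v\<in>verts G. (u, v) \<in> (adj_rel G)\<^sup>*)"

definition is_cycle :: "'a ugraph \<Rightarrow> 'a list \<Rightarrow> bool" where
  "is_cycle G xs \<longleftrightarrow>
     3 \<le> length xs \<and> distinct xs \<and>
     (\<forall>i<length xs. {xs ! i, xs ! (Suc i mod length xs)} \<in> edges G)"

definition is_tree :: "'a ugraph \<Rightarrow> bool" where
  "is_tree T \<longleftrightarrow> simple_graph T \<and> connected_graph T \<and> (\<nexists>xs. is_cycle T xs)"

definition tree_connecting :: "'a ugraph \<Rightarrow> 'a set \<Rightarrow> 'a ugraph \<Rightarrow> bool" where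
  "tree_connecting G S T \<longleftrightarrow> subgraph T G \<and> is_tree T \<and> S \<subseteq> verts T"

definition tree_packing :: "'a ugraph \<Rightarrow> 'a set \<Rightarrow> 'a ugraph set \<Rightarrow> bool" where
  "tree_packing G S TT \<longleftrightarrow>
     (\<forall>T\<in>TT. tree_connecting G S T) \<and>
     pairwise (\<lambda>T T'. edges T \<inter> edges T' = {}) TT"

text \<open>
  Packings are sets of trees. If \<open>S\<close> has at least two elements, every tree connecting \<open>S\<close>
  has an edge, so edge-disjoint trees are automatically distinct and nothing is lost by not
  counting multiplicities. The maxima are only meaningful for \<open>card S \<ge> 2\<close> and
  \<open>2 \<le> k \<le> card (verts G)\<close>; the lemmas below show that they are then attained.
\<close>

definition tree_conn :: "'a ugraph \<Rightarrow> 'a set \<Rightarrow> nat" where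
  "tree_conn G S = Max {card TT | TT. tree_packing G S TT}"

definition max_tree_conn :: "nat \<Rightarrow> 'a ugraph \<Rightarrow> nat" where
  "max_tree_conn k G = Max {tree_conn G S | S. S \<subseteq> verts G \<and> card S = k}"

lemma tree_conn_wf:
  assumes "simple_graph G"
  shows "tree_packing G S TT \<Longrightarrow> finite TT"
    and "finite {card TT | TT. tree_packing G S TT}"
    and "{card TT | TT. tree_packing G S TT} \<noteq> {}"
proof -
  have "finite (edges G)"
    using assms finite_subset[of "edges G" "Pow (verts G)"]
    by (auto simp: simple_graph_def)
  then have fin: "finite (Pow (verts G) \<times> Pow (edges G))"
    using assms by (simp add: simple_graph_def)
  have sub: "TT \<subseteq> Pow (verts G) \<times> Pow (edges G)" if "tree_packing G S TT" for TT
    using that by (fastforce simp: tree_packing_def tree_connecting_def subgraph_def)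
  show "finite TT" if "tree_packing G S TT"
    using finite_subset[OF sub[OF that] fin] .
  have "{card TT | TT. tree_packing G S TT} \<subseteq> card ` Pow (Pow (verts G) \<times> Pow (edges G))"
    using sub by blast
  then show "finite {card TT | TT. tree_packing G S TT}"
    using fin by (meson finite_Pow_iff finite_imageI finite_subset)
  have "tree_packing G S {}"
    by (simp add: tree_packing_def)
  then show "{card TT | TT. tree_packing G S TT} \<noteq> {}"
    by blast
qed

lemma max_tree_conn_wf:
  assumes "simple_graph G" "k \<le> card (verts G)"
  shows "finite {tree_conn G S | S. S \<subseteq> verts G \<and> card S = k}"
    and "{tree_conn G S | S. S \<subseteq> verts G \<and> card S = k} \<noteq> {}"
proof -
  have "{tree_conn G S | S. S \<subseteq> verts G \<and> card S = k} \<subseteq> tree_conn G ` Pow (verts G)"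
    by blast
  then show "finite {tree_conn G S | S. S \<subseteq> verts G \<and> card S = k}"
    using assms by (meson finite_Pow_iff finite_imageI finite_subset simple_graph_def)
  obtain S where "S \<subseteq> verts G" "card S = k"
    using obtain_subset_with_card_n[OF assms(2)] by metis
  then show "{tree_conn G S | S. S \<subseteq> verts G \<and> card S = k} \<noteq> {}"
    by blast
qed

definition graph_iso :: "'a ugraph \<Rightarrow> 'b ugraph \<Rightarrow> bool" (infix "\<simeq>\<^sub>g" 50) where
  "G \<simeq>\<^sub>g H \<longleftrightarrow>
     (\<exists>f. bij_betw f (verts G) (verts H) \<and>
          (\<forall>u\<in>verts G. \<forall>v\<in>verts G. {u, v} \<in> edges G \<longleftrightarrow> {f u, f v} \<in> edges H))"

definition complete_graph :: "nat \<Rightarrow> nat ugraph" where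
  "complete_graph n = ({..<n}, {e. e \<subseteq> {..<n} \<and> card e = 2})"

definition delete_edges :: "'a ugraph \<Rightarrow> 'a set set \<Rightarrow> 'a ugraph" where
  "delete_edges G M = (verts G, edges G - M)"

definition add_vertex :: "'a ugraph \<Rightarrow> 'a \<Rightarrow> 'a set \<Rightarrow> 'a ugraph" where
  "add_vertex G v A = (insert v (verts G), edges G \<union> {{v, a} | a. a \<in> A})"

text \<open>
  Since \<open>complete_graph (n - 1)\<close> has vertex set \<open>{..<n - 1}\<close>, the number \<open>n - 1\<close> serves as
  the new vertex. The class below contains representatives on \<open>{..<n}\<close>; membership of an
  arbitrary graph is to be read up to isomorphism.
\<close>

definition extremal_class :: "nat \<Rightarrow> nat \<Rightarrow> nat ugraph set" where
  "extremal_class n l =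
     {add_vertex (complete_graph (n - 1)) (n - 1) A | A.
        A \<subseteq> verts (complete_graph (n - 1)) \<and> card A = l}"

end

theory Submission imports Defs begin

text \<open>
  Put \<open>k = l + 1\<close> and let \<open>H\<close> be the set of edges missing from \<open>G\<close>. If \<open>H\<close> is small, then \<open>G\<close>
  has \<open>k\<close> edge-disjoint spanning trees, without any appeal to the Nash-Williams--Tutte theorem:
  a vertex of degree at least \<open>k\<close> can be deleted and later hung as a leaf on every tree, which
  reduces everything to \<open>n = 2k + 1\<close> and \<open>card H = k\<close>. There some vertex \<open>v\<close> is not touched by \<open>H\<close>;
  take a vertex \<open>u\<close> touched by \<open>H\<close>. By induction the graph without \<open>u\<close> and \<open>v\<close>, and without a few
  further edges, has \<open>k - 1\<close> trees, on which \<open>u\<close> and \<open>v\<close> are hung as leaves. The unused edges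
  form the last tree, a double star with centres \<open>u\<close> and \<open>v\<close> with some further leaves attached.
  The complete graph on \<open>2k\<close> vertices follows by adding one vertex to \<open>2k - 1\<close> vertices with a star
  of \<open>k - 1\<close> edges missing.
\<close>

section \<open>Trees built leaf by leaf\<close>

text \<open>Every tree here is constructed explicitly, so trees are generated leaf by leaf and their
  properties follow by induction; \<open>tree_on_is_tree\<close> gives the link to
  \<open>is_tree\<close>.\<close>

inductive tree_on :: "'a set \<Rightarrow> 'a set set \<Rightarrow> bool" where
  single: "tree_on {v} {}"
| leaf: "tree_on V E \<Longrightarrow> w \<notin> V \<Longrightarrow> x \<in> V \<Longrightarrow> tree_on (insert w V) (insert {w, x} E)"

text \<open>The edge set of the complete graph on \<open>V\<close>; a graph on \<open>V\<close> is
  handled through its missing edges \<open>H\<close>, as \<open>pairs V - H\<close>.\<close>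

definition pairs :: "'a set \<Rightarrow> 'a set set" where
  "pairs V = {e. e \<subseteq> V \<and> card e = 2}"

definition star :: "'a \<Rightarrow> 'a set \<Rightarrow> 'a set set" where
  "star v X = (\<lambda>x. {v, x}) ` X"

lemma pair_in_pairs: "{a, b} \<in> pairs V \<longleftrightarrow> a \<in> V \<and> b \<in> V \<and> a \<noteq> b"
  by (auto simp: pairs_def card_insert_if)

lemma pairsE:
  assumes "e \<in> pairs V"
  obtains a b where "e = {a, b}" "a \<in> V" "b \<in> V" "a \<noteq> b"
  using assms by (auto simp: pairs_def card_2_iff)

lemma finite_pairs: "finite V \<Longrightarrow> finite (pairs V)"
  by (simp add: pairs_def)

lemma card_pairs: "finite V \<Longrightarrow> card (pairs V) = card V choose 2"
  unfolding pairs_def by (rule n_subsets)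

lemma pairs_mono: "V \<subseteq> W \<Longrightarrow> pairs V \<subseteq> pairs W"
  by (auto simp: pairs_def)

lemma inj_on_pair: "inj_on (\<lambda>x. {v, x}) X"
  by (auto simp: inj_on_def doubleton_eq_iff)

lemma card_star: "card (star v X) = card X"
  unfolding star_def by (rule card_image[OF inj_on_pair])

lemma finite_star: "finite X \<Longrightarrow> finite (star v X)"
  by (simp add: star_def)

lemma star_subset_pairs: "v \<in> V \<Longrightarrow> X \<subseteq> V \<Longrightarrow> v \<notin> X \<Longrightarrow> star v X \<subseteq> pairs V"
  by (auto simp: star_def pair_in_pairs)

text \<open>Turns the number of missing edges at \<open>v\<close> into the number of non-neighbours
  of \<open>v\<close>, by way of \<open>card_star\<close>.\<close>

lemma incident_eq_star:
  assumes "H \<subseteq> pairs V"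
  shows "{e \<in> H. v \<in> e} = star v {x \<in> V - {v}. {v, x} \<in> H}"
proof -
  have "e \<in> star v {x \<in> V - {v}. {v, x} \<in> H}" if e: "e \<in> H" "v \<in> e" for e
  proof -
    have "e \<in> pairs V"
      using e assms by blast
    then obtain a b where "e = {a, b}" "a \<in> V" "b \<in> V" "a \<noteq> b"
      by (rule pairsE)
    then obtain x where "e = {v, x}" "x \<in> V - {v}"
      using e(2) by (metis Diff_iff insertE insert_commute singletonD)
    then show ?thesis
      using e(1) by (simp add: star_def)
  qed
  then show ?thesis
    by (auto simp: star_def)
qed

lemma tree_on_finite: "tree_on V E \<Longrightarrow> finite V"
  by (induction rule: tree_on.induct) auto

lemma tree_on_pairs: "tree_on V E \<Longrightarrow> E \<subseteq> pairs V"
proof (induction rule: tree_on.induct)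
  case (leaf V E w x)
  then show ?case
    using pairs_mono[of V "insert w V"] by (auto simp: pair_in_pairs)
qed simp

lemma tree_on_edge:
  assumes "tree_on V E" "card V \<ge> 2"
  shows "E \<noteq> {}"
  using assms by (cases rule: tree_on.cases) auto

lemma tree_on_add_leaves:
  assumes "tree_on V E" "finite W" "W \<inter> V = {}" "f ` W \<subseteq> V"
  shows "tree_on (V \<union> W) (E \<union> (\<lambda>w. {w, f w}) ` W)"
  using assms(2-4)
proof (induction W rule: finite_induct)
  case (insert w W)
  then have "tree_on (insert w (V \<union> W)) (insert {w, f w} (E \<union> (\<lambda>w. {w, f w}) ` W))"
    by (intro tree_on.leaf) auto
  then show ?case
    by simp
qed (use assms in simp)

lemma tree_on_add_star:
  assumes "tree_on V E" "finite W" "W \<inter> V = {}" "v \<in> V"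
  shows "tree_on (V \<union> W) (E \<union> star v W)"
  using tree_on_add_leaves[OF assms(1-3), of "\<lambda>_. v"] assms(4)
  by (auto simp: star_def insert_commute)

lemma tree_on_connected: "tree_on V E \<Longrightarrow> connected_graph (V, E)"
proof (induction rule: tree_on.induct)
  case (single v)
  then show ?case
    by (simp add: connected_graph_def)
next
  case (leaf V E w x)
  let ?R = "adj_rel (insert w V, insert {w, x} E)"
  have "adj_rel (V, E) \<subseteq> ?R"
    by (auto simp: adj_rel_def)
  then have mono: "(a, b) \<in> ?R\<^sup>*" if "(a, b) \<in> (adj_rel (V, E))\<^sup>*" for a b
    using that rtrancl_mono by blast
  have "(w, x) \<in> ?R" "(x, w) \<in> ?R"
    by (auto simp: adj_rel_def insert_commute)
  then have R: "(a, x) \<in> ?R\<^sup>* \<and> (x, a) \<in> ?R\<^sup>*" if "a \<in> insert w V" for a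
    using that leaf mono by (auto simp: connected_graph_def)
  have "(a, b) \<in> ?R\<^sup>*" if "a \<in> insert w V" "b \<in> insert w V" for a b
    using R[OF that(1)] R[OF that(2)] by (meson rtrancl_trans)
  then show ?case
    unfolding connected_graph_def by simp
qed

text \<open>The new leaf \<open>w\<close> has \<open>x\<close> as its only neighbour, whereas a
  vertex on a cycle has two; a cycle that avoids \<open>w\<close> uses old edges only.\<close>

lemma tree_on_acyclic: "tree_on V E \<Longrightarrow> \<not> is_cycle (V, E) xs"
proof (induction rule: tree_on.induct)
  case (single v)
  then show ?case
    by (auto simp: is_cycle_def intro!: exI[of _ 0])
next
  case (leaf V E w x)
  have EV: "\<And>e. e \<in> E \<Longrightarrow> w \<notin> e"
    using tree_on_pairs[OF leaf(1)] leaf(2) by (auto simp: pairs_def)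
  show ?case
  proof
    assume "is_cycle (insert w V, insert {w, x} E) xs"
    then have len: "3 \<le> length xs" and dist: "distinct xs"
      and cyc: "\<And>i. i < length xs \<Longrightarrow> {xs ! i, xs ! (Suc i mod length xs)} \<in> insert {w, x} E"
      by (auto simp: is_cycle_def)
    let ?n = "length xs"
    have [simp]: "xs \<noteq> []"
      using len by auto
    show False
    proof (cases "w \<in> set xs")
      case True
      then obtain i where i: "i < ?n" "xs ! i = w"
        by (auto simp: in_set_conv_nth)
      \<comment> \<open>\<open>p\<close> and \<open>s\<close> are the cyclic predecessor and
        successor of position \<open>i\<close>; they differ because the length is at least
        3.\<close>
      define p where "p = (if i = 0 then ?n - 1 else i - 1)"
      define s where "s = (if i = ?n - 1 then 0 else Suc i)"
      have s: "s < ?n" "Suc i mod ?n = s" and p: "p < ?n" "Suc p mod ?n = i"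
        using i len by (auto simp: p_def s_def)
      have "p \<noteq> s" "s \<noteq> i" "p \<noteq> i"
        using i len by (auto simp: p_def s_def split: if_splits)
      have "{w, xs ! s} = {w, x}"
        using cyc[OF i(1)] s i EV by auto
      moreover have "{xs ! p, w} = {w, x}"
        using cyc[OF p(1)] p i EV by auto
      ultimately have "xs ! s = xs ! p"
        by (auto simp: doubleton_eq_iff)
      then show False
        using \<open>p \<noteq> s\<close> s p dist nth_eq_iff_index_eq by metis
    next
      case False
      have "{xs ! i, xs ! (Suc i mod ?n)} \<in> E" if i: "i < ?n" for i
      proof -
        have "Suc i mod ?n < ?n"
          using i by (intro mod_less_divisor) auto
        then have "xs ! i \<in> set xs" "xs ! (Suc i mod ?n) \<in> set xs"
          using i by auto
        then show ?thesis
          using cyc[OF i] False by (auto simp: doubleton_eq_iff)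
      qed
      then have "is_cycle (V, E) xs"
        using len dist by (simp add: is_cycle_def)
      then show False
        using leaf by simp
    qed
  qed
qed

lemma tree_on_is_tree: "tree_on V E \<Longrightarrow> is_tree (V, E)"
  using tree_on_finite[of V E] tree_on_pairs[of V E] tree_on_connected[of V E]
    tree_on_acyclic[of V E]
  by (auto simp: is_tree_def simple_graph_def pairs_def)

section \<open>Packings of spanning trees\<close>

text \<open>Trees are counted by index. Two indices can share an edge set only if it is empty, that
  is, if \<open>V\<close> is a single vertex.\<close>

definition packs :: "'a set \<Rightarrow> 'a set set \<Rightarrow> nat \<Rightarrow> bool" where
  "packs V E k \<longleftrightarrow> (\<exists>T. (\<forall>i<k. tree_on V (T i) \<and> T i \<subseteq> E) \<and>
     (\<forall>i<k. \<forall>j<k. i \<noteq> j \<longrightarrow> T i \<inter> T j = {}))"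

lemma packs_mono:
  assumes "packs V E k" "E \<subseteq> F"
  shows "packs V F k"
proof -
  obtain T where "\<forall>i<k. tree_on V (T i) \<and> T i \<subseteq> E"
    "\<forall>i<k. \<forall>j<k. i \<noteq> j \<longrightarrow> T i \<inter> T j = {}"
    using assms(1) unfolding packs_def by blast
  note T = this[rule_format]
  have "T i \<subseteq> F" if "i < k" for i
    using T(1)[OF that] assms(2) by blast
  then show ?thesis
    unfolding packs_def using T by (intro exI[of _ T]) simp
qed

lemma packs_add_tree:
  assumes "packs V E k" "tree_on V F" "E \<inter> F = {}"
  shows "packs V (E \<union> F) (Suc k)"
proof -
  obtain T where "\<forall>i<k. tree_on V (T i) \<and> T i \<subseteq> E"
    "\<forall>i<k. \<forall>j<k. i \<noteq> j \<longrightarrow> T i \<inter> T j = {}"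
    using assms(1) unfolding packs_def by blast
  note T = this[rule_format]
  have "T i \<inter> F = {}" if "i < k" for i
    using T(1)[OF that] assms(3) by blast
  then have TF: "T i \<inter> F = {}" "F \<inter> T i = {}" if "i < k" for i
    using that by auto
  show ?thesis
    unfolding packs_def
  proof (intro exI[of _ "T(k := F)"] conjI allI impI)
    fix i assume "i < Suc k"
    then show "tree_on V ((T(k := F)) i)" "(T(k := F)) i \<subseteq> E \<union> F"
      using T(1)[of i] assms(2) by (auto simp: less_Suc_eq)
  next
    fix i j assume "i < Suc k" "j < Suc k" "i \<noteq> j"
    then consider "i = k" "j < k" | "j = k" "i < k" | "i < k" "j < k"
      by linarith
    then show "(T(k := F)) i \<inter> (T(k := F)) j = {}"
      using T(2)[of i j] TF \<open>i \<noteq> j\<close> by cases simp_all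
  qed
qed

text \<open>An injection \<open>g\<close> of the tree indices into \<open>X\<close> gives each tree
  its own edge \<open>{v, g i}\<close>, by which \<open>v\<close> is hung on it as a leaf.\<close>

lemma packs_add_vertex:
  assumes "packs V E k" "E \<subseteq> pairs V" "v \<notin> V" "X \<subseteq> V" "finite X" "k \<le> card X"
  shows "packs (insert v V) (E \<union> star v X) k"
proof -
  obtain T where "\<forall>i<k. tree_on V (T i) \<and> T i \<subseteq> E"
    "\<forall>i<k. \<forall>j<k. i \<noteq> j \<longrightarrow> T i \<inter> T j = {}"
    using assms(1) unfolding packs_def by blast
  note T = this[rule_format]
  obtain g where g: "g ` {..<k} \<subseteq> X" "inj_on g {..<k}"
    using card_le_inj[of "{..<k}" X] assms(5,6) by auto
  have new: "{v, y} \<notin> T i" if "i < k" for i y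
    using T(1)[OF that] assms(2,3) by (auto simp: pairs_def)
  show ?thesis
    unfolding packs_def
  proof (intro exI[of _ "\<lambda>i. insert {v, g i} (T i)"] conjI allI impI)
    fix i assume i: "i < k"
    then show "tree_on (insert v V) (insert {v, g i} (T i))"
      using T(1) g assms(3,4) by (intro tree_on.leaf) auto
    show "insert {v, g i} (T i) \<subseteq> E \<union> star v X"
      using T(1)[OF i] g i by (auto simp: star_def)
  next
    fix i j assume ij: "i < k" "j < k" "i \<noteq> j"
    then have "g i \<noteq> g j"
      using g by (auto simp: inj_on_def)
    then have "{v, g i} \<noteq> {v, g j}"
      by (simp add: doubleton_eq_iff)
    then show "insert {v, g i} (T i) \<inter> insert {v, g j} (T j) = {}"
      using T(2)[OF ij] new[OF ij(1), of "g j"] new[OF ij(2), of "g i"] by simp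
  qed
qed

text \<open>The degree of \<open>v\<close> in \<open>pairs V - H\<close> is
  \<open>card V - 1\<close> minus the number of missing edges at \<open>v\<close>. The last
  hypothesis makes it at least \<open>k\<close>, so \<open>packs_add_vertex\<close> can put
  \<open>v\<close> back.\<close>

lemma packs_delete_vertex:
  assumes "finite V" "v \<in> V" "H \<subseteq> pairs V"
    and "packs (V - {v}) (pairs (V - {v}) - {e \<in> H. v \<notin> e}) k"
    and "card {e \<in> H. v \<in> e} + k < card V"
  shows "packs V (pairs V - H) k"
proof -
  define D where "D = {x \<in> V - {v}. {v, x} \<in> H}"
  have "card D = card {e \<in> H. v \<in> e}"
    unfolding incident_eq_star[OF assms(3)] card_star D_def ..
  moreover have "card (V - {v} - D) = card V - 1 - card D"
    using assms(1,2) by (subst card_Diff_subset) (auto simp: D_def)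
  ultimately have "k \<le> card (V - {v} - D)"
    using assms(5) by simp
  then have "packs (insert v (V - {v}))
      (pairs (V - {v}) - {e \<in> H. v \<notin> e} \<union> star v (V - {v} - D)) k"
    using assms by - (rule packs_add_vertex, auto)
  then have "packs V (pairs (V - {v}) - {e \<in> H. v \<notin> e} \<union> star v (V - {v} - D)) k"
    using assms(2) by (simp add: insert_absorb)
  then show ?thesis
  proof (rule packs_mono)
    have "star v (V - {v} - D) \<subseteq> pairs V - H"
      using assms(2) by (auto simp: star_def D_def pair_in_pairs)
    then show "pairs (V - {v}) - {e \<in> H. v \<notin> e} \<union> star v (V - {v} - D) \<subseteq> pairs V - H"
      by (auto simp: pairs_def)
  qed
qed

section \<open>Packings when few edges are missing\<close>

text \<open>
  The tight case: all edges outside \<open>H\<close> are used. The last tree joins \<open>u\<close> to \<open>A\<close>, \<open>v\<close> to \<open>B\<close>,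
  and every \<open>c \<in> C\<close> to some \<open>f c \<in> A \<union> B\<close>; the sizes are forced by counting edges at \<open>u\<close> and \<open>v\<close>.
\<close>

lemma packs_odd:
  assumes "finite V" "card V = 2 * k + 1" "H \<subseteq> pairs V" "card H = k"
  shows "packs V (pairs V - H) k"
  using assms
proof (induction k arbitrary: V H)
  case 0
  then show ?case
    by (simp add: packs_def)
next
  case (Suc k)
  note fV = Suc.prems(1) and HV = Suc.prems(3)
  have fH: "finite H"
    using finite_subset[OF HV finite_pairs[OF fV]] .
  \<comment> \<open>The \<open>Suc k\<close> edges of \<open>H\<close> cover at most
    \<open>2 * Suc k\<close> of the \<open>2 * Suc k + 1\<close> vertices.\<close>
  have "card (\<Union>H) \<le> (\<Sum>e\<in>H. card e)"
    by (rule card_Union_le_sum_card)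
  also have "\<dots> = (\<Sum>e\<in>H. 2)"
    using HV by (intro sum.cong) (auto simp: pairs_def)
  finally have "card (\<Union>H) < card V"
    using Suc.prems by simp
  moreover have "\<Union>H \<subseteq> V"
    using HV by (auto simp: pairs_def)
  ultimately obtain v where v: "v \<in> V" "v \<notin> \<Union>H"
    by (metis less_irrefl subsetI subset_antisym)
  have "H \<noteq> {}"
    using Suc.prems(4) by auto
  then obtain e where e: "e \<in> H"
    by blast
  then obtain u where u: "u \<in> e"
    using HV by (metis pairsE insertI1 subsetD)
  have uV: "u \<in> V" "u \<noteq> v"
    using e u v \<open>\<Union>H \<subseteq> V\<close> by auto
  define V' where "V' = V - {u, v}"
  have fV': "finite V'" and cV': "card V' = 2 * k + 1"
    using fV uV v Suc.prems(2) by (auto simp: V'_def card_Diff_subset)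
  have V: "V = insert v (insert u V')" and uv: "u \<notin> V'" "v \<notin> V'"
    using uV v by (auto simp: V'_def)
  define D where "D = {x \<in> V'. {u, x} \<in> H}"
  define d where "d = card D"
  have "{x \<in> V - {u}. {u, x} \<in> H} = D"
    using v by (auto simp: D_def V'_def)
  then have Hu: "{e \<in> H. u \<in> e} = star u D"
    using incident_eq_star[OF HV, of u] by simp
  define H1 where "H1 = {e \<in> H. u \<notin> e}"
  have cHu: "card {e \<in> H. u \<in> e} = d"
    unfolding Hu card_star d_def ..
  have "H1 = H - {e \<in> H. u \<in> e}"
    by (auto simp: H1_def)
  then have cH1: "card H1 = Suc k - d"
    using fH cHu Suc.prems(4) by (simp add: card_Diff_subset)
  have d: "1 \<le> d" "d \<le> Suc k"
  proof -
    have "0 < card {e \<in> H. u \<in> e}"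
      using e u fH by (auto simp: card_gt_0_iff)
    then show "1 \<le> d"
      using cHu by simp
    show "d \<le> Suc k"
      using card_mono[OF fH, of "{e \<in> H. u \<in> e}"] cHu Suc.prems(4) by auto
  qed
  have H1V: "H1 \<subseteq> pairs V'"
    using HV v by (auto simp: H1_def pairs_def V'_def)
  have fD: "finite D" "D \<subseteq> V'"
    using fV' by (auto simp: D_def)
  \<comment> \<open>Of the \<open>2 * k + 1 - d\<close> edges from \<open>u\<close> into
    \<open>V'\<close>, \<open>k\<close> are reserved for hanging \<open>u\<close> on the inductive
    trees; the other \<open>Suc k - d\<close> lead to \<open>A\<close>.\<close>
  have "card (V' - D) = 2 * k + 1 - d"
    using fD cV' by (simp add: card_Diff_subset d_def)
  moreover have "Suc k - d \<le> 2 * k + 1 - d"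
    by simp
  ultimately obtain A where A: "A \<subseteq> V' - D" "card A = Suc k - d"
    by (metis obtain_subset_with_card_n)
  have fA: "finite A"
    using A(1) fV' by (meson finite_Diff finite_subset)
  \<comment> \<open>All \<open>2 * k + 1\<close> edges from \<open>v\<close> into \<open>V'\<close>
    are present; \<open>k\<close> of them are reserved, which leaves \<open>Suc k\<close> for
    \<open>B\<close>. There is room beside \<open>A\<close> because \<open>1 \<le> d\<close>, that
    is, because \<open>u\<close> is touched by \<open>H\<close>.\<close>
  have "card (V' - A) = k + d"
    using A fA cV' d by (subst card_Diff_subset) auto
  moreover have "Suc k \<le> k + d"
    using d by simp
  ultimately obtain B where B: "B \<subseteq> V' - A" "card B = Suc k"
    by (metis obtain_subset_with_card_n)
  have fB: "finite B"
    using B(1) fV' by (meson finite_Diff finite_subset)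
  define C where "C = V' - (A \<union> B)"
  have cAB: "card (A \<union> B) = 2 * Suc k - d"
    using A B fA fB d by (subst card_Un_disjoint) auto
  have "card C = card V' - card (A \<union> B)"
    unfolding C_def using A B fA fB by (intro card_Diff_subset) auto
  then have cC: "card C = d - 1"
    using cAB cV' d by simp
  have fC: "finite C"
    using fV' by (simp add: C_def)
  \<comment> \<open>Otherwise all \<open>2 * Suc k - d\<close> edges from \<open>c\<close> to
    \<open>A \<union> B\<close> would lie in \<open>H1\<close>, which has only
    \<open>Suc k - d\<close>.\<close>
  have "\<exists>x. x \<in> A \<union> B \<and> {c, x} \<notin> H" if c: "c \<in> C" for c
  proof (rule ccontr)
    assume "\<not> ?thesis"
    then have "star c (A \<union> B) \<subseteq> H1"
      using c A B uv by (auto simp: star_def H1_def C_def)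
    then have "card (A \<union> B) \<le> card H1"
      using card_mono[of H1 "star c (A \<union> B)"] fH by (simp add: card_star H1_def)
    then show False
      using cAB cH1 d by simp
  qed
  then obtain f where f: "\<And>c. c \<in> C \<Longrightarrow> f c \<in> A \<union> B \<and> {c, f c} \<notin> H"
    by metis
  define E where "E = (\<lambda>c. {c, f c}) ` C"
  have "inj_on (\<lambda>c. {c, f c}) C"
  proof (rule inj_onI)
    fix c c' assume c: "c \<in> C" "c' \<in> C" "{c, f c} = {c', f c'}"
    then have "c \<noteq> f c'"
      using f[of c'] by (auto simp: C_def)
    then show "c = c'"
      using c(3) by (auto simp: doubleton_eq_iff)
  qed
  then have cE: "card E = d - 1"
    unfolding E_def using cC by (simp add: card_image)
  have EV: "E \<subseteq> pairs V'"
    using f A B by (fastforce simp: E_def pair_in_pairs C_def)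
  have EH: "E \<inter> H = {}"
    using f by (auto simp: E_def)
  \<comment> \<open>The count closes: \<open>Suc k - d\<close> old missing edges and
    \<open>d - 1\<close> edges lent to the last tree make the \<open>k\<close> that the induction
    hypothesis asks for on \<open>V'\<close>.\<close>
  have "card (H1 \<union> E) = k"
    using EH fH fC cE cH1 d by (subst card_Un_disjoint) (auto simp: H1_def E_def)
  then have "packs V' (pairs V' - (H1 \<union> E)) k"
    using Suc.IH[OF fV' cV', of "H1 \<union> E"] H1V EV by simp
  moreover have "card (V' - D - A) = k"
    using A fA \<open>card (V' - D) = 2 * k + 1 - d\<close> d by (simp add: card_Diff_subset)
  ultimately have "packs (insert u V') (pairs V' - (H1 \<union> E) \<union> star u (V' - D - A)) k"
    using uv fV' by - (rule packs_add_vertex, auto)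
  moreover have "card (V' - B) = k"
    using B fB cV' by (subst card_Diff_subset) auto
  moreover have "pairs V' - (H1 \<union> E) \<union> star u (V' - D - A) \<subseteq> pairs (insert u V')"
    using uv pairs_mono[of V' "insert u V'"] by (auto simp: star_def pair_in_pairs)
  ultimately have
    "packs V (pairs V' - (H1 \<union> E) \<union> star u (V' - D - A) \<union> star v (V' - B)) k"
    unfolding V using uv uV fV' by - (rule packs_add_vertex, auto)
  moreover have "tree_on V ({{u, v}} \<union> star u A \<union> star v B \<union> E)"
  proof -
    have "tree_on {u, v} {{u, v}}"
      using tree_on.leaf[OF tree_on.single[of v], of u v] uV by simp
    then have "tree_on ({u, v} \<union> A) ({{u, v}} \<union> star u A)"
      by (rule tree_on_add_star) (use A fA uv in auto)
    then have "tree_on ({u, v} \<union> A \<union> B) ({{u, v}} \<union> star u A \<union> star v B)"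
      by (rule tree_on_add_star) (use A B fB uv in auto)
    then have "tree_on ({u, v} \<union> A \<union> B \<union> C) ({{u, v}} \<union> star u A \<union> star v B \<union> E)"
      unfolding E_def by (rule tree_on_add_leaves) (use f fC uv in \<open>auto simp: C_def\<close>)
    moreover have "{u, v} \<union> A \<union> B \<union> C = V"
      using A B by (auto simp: C_def V)
    ultimately show ?thesis
      by simp
  qed
  moreover have "(pairs V' - (H1 \<union> E) \<union> star u (V' - D - A) \<union> star v (V' - B))
      \<inter> ({{u, v}} \<union> star u A \<union> star v B \<union> E) = {}"
  proof -
    have "u \<notin> e" "v \<notin> e" if "e \<in> pairs V'" for e
      using that uv by (auto simp: pairs_def)
    moreover have "star u (V' - D - A) \<inter> ({{u, v}} \<union> star u A \<union> star v B) = {}"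
      "star v (V' - B) \<inter> ({{u, v}} \<union> star u A \<union> star v B) = {}"
      using uv uV A B by (auto simp: star_def doubleton_eq_iff)
    moreover have "u \<in> e" if "e \<in> star u X" for e and X :: "'a set"
      using that by (auto simp: star_def)
    moreover have "v \<in> e" if "e \<in> star v X" for e and X :: "'a set"
      using that by (auto simp: star_def)
    ultimately show ?thesis
      using EV by blast
  qed
  ultimately have "packs V (pairs V' - (H1 \<union> E) \<union> star u (V' - D - A) \<union> star v (V' - B)
      \<union> ({{u, v}} \<union> star u A \<union> star v B \<union> E)) (Suc k)"
    by (rule packs_add_tree)
  then show ?case
  proof (rule packs_mono)
    have "pairs V' - (H1 \<union> E) \<union> E \<subseteq> pairs V - H"
      using EV EH uv pairs_mono[of V' V] by (auto simp: H1_def pairs_def V)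
    moreover have "star u (V' - D - A) \<union> star u A \<subseteq> pairs V - H"
      using A uV uv by (auto simp: star_def D_def pair_in_pairs V)
    moreover have "star v (V' - B) \<union> star v B \<subseteq> pairs V - H"
      using B uV uv v by (auto simp: star_def pair_in_pairs V)
    moreover have "{{u, v}} \<subseteq> pairs V - H"
      using uV v by (auto simp: pair_in_pairs)
    ultimately show "pairs V' - (H1 \<union> E) \<union> star u (V' - D - A) \<union> star v (V' - B)
      \<union> ({{u, v}} \<union> star u A \<union> star v B \<union> E) \<subseteq> pairs V - H"
      by blast
  qed
qed

text \<open>The last tree joins the new vertex \<open>v\<close> to \<open>B\<close> and some
  \<open>b \<in> B\<close> to the rest \<open>W - B\<close>. Without the latter star,
  \<open>W\<close> has \<open>j\<close> trees by \<open>packs_odd\<close>, and the \<open>j\<close>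
  edges from \<open>v\<close> to \<open>W - B\<close> hang \<open>v\<close> on them.\<close>

lemma packs_even:
  assumes "finite V" "card V = 2 * k" "0 < k"
  shows "packs V (pairs V) k"
proof -
  obtain j where k: "k = Suc j"
    using assms(3) gr0_implies_Suc by blast
  obtain v where v: "v \<in> V"
    using assms by fastforce
  define W where "W = V - {v}"
  have W: "finite W" "card W = 2 * j + 1" "V = insert v W" "v \<notin> W"
    using assms v k by (auto simp: W_def)
  have "Suc j \<le> card W"
    using W assms k by simp
  then obtain B where B: "B \<subseteq> W" "card B = Suc j" "finite B"
    by (metis obtain_subset_with_card_n)
  then obtain b where b: "b \<in> B"
    by fastforce
  have cC: "card (W - B) = j"
    using B W by (simp add: card_Diff_subset)
  have H: "star b (W - B) \<subseteq> pairs W"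
    using b B by (intro star_subset_pairs) auto
  have "packs W (pairs W - star b (W - B)) j"
    using W H cC by (intro packs_odd) (auto simp: card_star)
  then have "packs V (pairs W - star b (W - B) \<union> star v (W - B)) j"
    unfolding W(3) using W cC by - (rule packs_add_vertex, auto)
  moreover have "tree_on V (star v B \<union> star b (W - B))"
  proof -
    have "tree_on ({v} \<union> B) ({} \<union> star v B)"
      using tree_on_add_star[OF tree_on.single[of v], of B v] B W by auto
    then have "tree_on ({v} \<union> B \<union> (W - B)) ({} \<union> star v B \<union> star b (W - B))"
      by (rule tree_on_add_star) (use B W b in auto)
    moreover have "{v} \<union> B \<union> (W - B) = V"
      using B W by auto
    ultimately show ?thesis
      by simp
  qed
  moreover have "(pairs W - star b (W - B) \<union> star v (W - B)) \<inter> (star v B \<union> star b (W - B)) = {}"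
    using W b B by (auto simp: star_def doubleton_eq_iff pair_in_pairs)
  ultimately have "packs V (pairs W - star b (W - B) \<union> star v (W - B)
      \<union> (star v B \<union> star b (W - B))) (Suc j)"
    by (rule packs_add_tree)
  then show ?thesis
    unfolding k
  proof (rule packs_mono)
    have "star v (W - B) \<union> star v B \<subseteq> pairs V"
      using B W by (auto simp: star_def pair_in_pairs)
    then show "pairs W - star b (W - B) \<union> star v (W - B) \<union> (star v B \<union> star b (W - B)) \<subseteq> pairs V"
      using H pairs_mono[of W V] W by blast
  qed
qed

text \<open>Deleting a vertex touched by \<open>H\<close> lowers both sides of the last hypothesis,
  and that hypothesis also gives every vertex degree at least \<open>k\<close>. Induction thus
  descends to \<open>2 * k + 1\<close> vertices.\<close>

lemma packs_few_missing:
  assumes "finite V" "2 * k + 1 \<le> card V" "H \<subseteq> pairs V" "card H + k + 1 \<le> card V"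
  shows "packs V (pairs V - H) k"
  using assms
proof (induction "card V - (2 * k + 1)" arbitrary: V H)
  case 0
  then have cV: "card V = 2 * k + 1"
    by simp
  \<comment> \<open>There are at least \<open>k\<close> pairs, so \<open>H\<close> can be padded to
    exactly \<open>k\<close> edges, as \<open>packs_odd\<close> requires.\<close>
  have "card (pairs V) = (2 * k + 1) * k"
    using 0 cV by (simp add: card_pairs choose_two)
  then have "card H \<le> k" "k \<le> card (pairs V)"
    using 0 cV by auto
  then obtain K where K: "H \<subseteq> K" "K \<subseteq> pairs V" "card K = k"
    using exists_subset_between[of H k "pairs V"] 0 finite_pairs by metis
  then show ?case
    using packs_odd[OF \<open>finite V\<close> cV K(2,3)] packs_mono by blast
next
  case (Suc m)
  have fH: "finite H"
    using Suc.prems finite_pairs finite_subset by blast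
  obtain v where v: "v \<in> V" and red: "card {e \<in> H. v \<notin> e} + k + 1 \<le> card V - 1"
  proof (cases "H = {}")
    case True
    obtain v where "v \<in> V"
      using Suc.prems by fastforce
    then show ?thesis
      using that Suc True by auto
  next
    case False
    then obtain e where e: "e \<in> H"
      by blast
    then obtain v where ve: "v \<in> V" "v \<in> e"
      using Suc.prems(3) by (metis insertI1 pairsE subsetD)
    then have "{e \<in> H. v \<notin> e} \<subset> H"
      using e by blast
    then have "card {e \<in> H. v \<notin> e} < card H"
      using fH psubset_card_mono by blast
    then show ?thesis
      using that ve Suc.prems by auto
  qed
  have cV: "card (V - {v}) = card V - 1"
    using v Suc.prems(1) by simp
  have "packs (V - {v}) (pairs (V - {v}) - {e \<in> H. v \<notin> e}) k"
  proof (rule Suc.hyps(1))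
    show "{e \<in> H. v \<notin> e} \<subseteq> pairs (V - {v})"
      using Suc.prems(3) by (auto simp: pairs_def)
  qed (use Suc.hyps(2) Suc.prems(1) cV red in auto)
  moreover have "card {e \<in> H. v \<in> e} \<le> card H"
    using fH by (intro card_mono) auto
  ultimately show ?case
    using Suc.prems v by (intro packs_delete_vertex[of V v]) auto
qed

text \<open>
  With one more missing edge the only obstruction is a vertex of degree less than \<open>k\<close>. A vertex
  touched by two missing edges is deleted; it exists because a matching has at most
  \<open>card V div 2\<close> edges.
\<close>

lemma packs_or_star:
  assumes "finite V" "2 * k + 2 \<le> card V" "H \<subseteq> pairs V" "card H + k = card V"
    and deg: "\<And>v. v \<in> V \<Longrightarrow> {e \<in> H. v \<in> e} \<noteq> H"
  shows "packs V (pairs V - H) k"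
proof -
  have fH: "finite H"
    using assms finite_pairs finite_subset by blast
  obtain v e e' where v: "v \<in> V" "v \<in> e" "v \<in> e'" "e \<in> H" "e' \<in> H" "e \<noteq> e'"
  proof (cases "pairwise disjnt H")
    case True
    have "card (\<Union>H) = (\<Sum>e\<in>H. card e)"
      using True assms(3) finite_subset[OF _ assms(1)]
      by (intro card_Union_disjoint) (auto simp: pairs_def)
    also have "\<dots> = (\<Sum>e\<in>H. 2)"
      using assms(3) by (intro sum.cong) (auto simp: pairs_def)
    finally have "card (\<Union>H) = 2 * card H"
      by simp
    moreover have "card (\<Union>H) \<le> card V"
      using assms(1,3) by (intro card_mono) (auto simp: pairs_def)
    ultimately show ?thesis
      using assms(2,4) by linarith
  next
    case False
    then obtain e e' v where "e \<in> H" "e' \<in> H" "e \<noteq> e'" "v \<in> e" "v \<in> e'"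
      by (auto simp: pairwise_def disjnt_def)
    moreover from this have "v \<in> V"
      using assms(3) by (auto simp: pairs_def)
    ultimately show ?thesis
      using that by blast
  qed
  \<comment> \<open>Not all missing edges meet \<open>v\<close>, so fewer than
    \<open>card V - k\<close> do, and \<open>v\<close> has degree at least \<open>k\<close>.\<close>
  have "{e \<in> H. v \<in> e} \<subset> H"
    using deg[OF v(1)] by auto
  then have lt: "card {e \<in> H. v \<in> e} < card H"
    using fH psubset_card_mono by blast
  have "card {e, e'} \<le> card {e \<in> H. v \<in> e}"
    using v fH by (intro card_mono) auto
  then have ge: "2 \<le> card {e \<in> H. v \<in> e}"
    using v by simp
  \<comment> \<open>Deleting \<open>v\<close> costs one vertex but at least two missing edges, which
    makes up for the one excess edge in \<open>packs_few_missing\<close>.\<close>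
  have "{e \<in> H. v \<notin> e} = H - {e \<in> H. v \<in> e}"
    by auto
  then have "card {e \<in> H. v \<notin> e} = card H - card {e \<in> H. v \<in> e}"
    using fH by (simp add: card_Diff_subset)
  moreover have "{e \<in> H. v \<notin> e} \<subseteq> pairs (V - {v})"
    using assms(3) by (auto simp: pairs_def)
  ultimately have "packs (V - {v}) (pairs (V - {v}) - {e \<in> H. v \<notin> e}) k"
    using assms(1,2,4) v ge by (intro packs_few_missing) auto
  then show ?thesis
    using assms(1,3,4) v lt by (intro packs_delete_vertex[of V v]) auto
qed

section \<open>Passage to the parameter \<open>max_tree_conn\<close>\<close>

lemma packs_imp_max_tree_conn_ge:
  assumes "simple_graph G" "card (verts G) = n" "2 \<le> n" "packs (verts G) (edges G) k"
  shows "k \<le> max_tree_conn n G"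
proof -
  have fV: "finite (verts G)"
    using assms(1) by (simp add: simple_graph_def)
  obtain T where "\<forall>i<k. tree_on (verts G) (T i) \<and> T i \<subseteq> edges G"
    "\<forall>i<k. \<forall>j<k. i \<noteq> j \<longrightarrow> T i \<inter> T j = {}"
    using assms(4) unfolding packs_def by blast
  note T = this[rule_format]
  define TT where "TT = (\<lambda>i. (verts G, T i)) ` {..<k}"
  \<comment> \<open>With at least two vertices each tree has an edge, so disjoint trees are distinct
    and the set \<open>TT\<close> really has \<open>k\<close> elements.\<close>
  have "T i \<noteq> {}" if "i < k" for i
    using tree_on_edge T(1)[OF that] assms by metis
  then have "inj_on (\<lambda>i. (verts G, T i)) {..<k}"
    using T(2) by (fastforce simp: inj_on_def)
  then have cTT: "card TT = k"
    unfolding TT_def by (simp add: card_image)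
  have "tree_packing G (verts G) TT"
    unfolding tree_packing_def
  proof
    have "tree_connecting G (verts G) (verts G, T i)" if "i < k" for i
      using tree_on_is_tree[of "verts G" "T i"] T(1)[OF that]
      by (simp add: tree_connecting_def subgraph_def is_tree_def)
    then show "\<forall>S\<in>TT. tree_connecting G (verts G) S"
      by (auto simp: TT_def)
    show "pairwise (\<lambda>S S'. edges S \<inter> edges S' = {}) TT"
      using T(2) by (fastforce simp: TT_def pairwise_def)
  qed
  then have "k \<le> tree_conn G (verts G)"
    unfolding tree_conn_def using cTT tree_conn_wf(2)[OF assms(1)]
    by (intro Max_ge) auto
  also have "tree_conn G (verts G) \<le> max_tree_conn n G"
    unfolding max_tree_conn_def using assms max_tree_conn_wf(1)[of G n]
    by (intro Max_ge) auto
  finally show ?thesis .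
qed

section \<open>Counting edges up to isomorphism\<close>

lemma simple_graph_edges: "simple_graph G \<Longrightarrow> edges G \<subseteq> pairs (verts G)"
  by (auto simp: simple_graph_def pairs_def)

lemma edges_complete_graph: "edges (complete_graph n) = pairs {..<n}"
  by (simp add: complete_graph_def pairs_def)

lemma verts_complete_graph: "verts (complete_graph n) = {..<n}"
  by (simp add: complete_graph_def)

text \<open>Pointwise preservation of adjacency becomes an equality of edge sets, from which edges
  can be counted.\<close>

lemma graph_iso_edges:
  assumes "simple_graph G" "simple_graph H"
    and f: "bij_betw f (verts G) (verts H)"
      "\<forall>u\<in>verts G. \<forall>v\<in>verts G. {u, v} \<in> edges G \<longleftrightarrow> {f u, f v} \<in> edges H"
  shows "edges H = (`) f ` edges G"
proof (intro equalityI subsetI)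
  fix e assume e: "e \<in> edges H"
  then obtain a b where ab: "e = {a, b}" "a \<in> verts H" "b \<in> verts H"
    using simple_graph_edges[OF assms(2)] by (meson pairsE subsetD)
  then have "a \<in> f ` verts G" "b \<in> f ` verts G"
    using f(1) by (auto simp: bij_betw_def)
  then obtain u v where "u \<in> verts G" "v \<in> verts G" "a = f u" "b = f v"
    by blast
  then show "e \<in> (`) f ` edges G"
    using e ab f(2) by (intro image_eqI[of _ _ "{u, v}"]) auto
next
  fix e assume "e \<in> (`) f ` edges G"
  then obtain e' where e': "e' \<in> edges G" "e = f ` e'"
    by blast
  then obtain a b where "e' = {a, b}" "a \<in> verts G" "b \<in> verts G"
    using simple_graph_edges[OF assms(1)] by (meson pairsE subsetD)
  then show "e \<in> edges H"
    using e' f(2) by auto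
qed

lemma graph_iso_card_edges:
  assumes "simple_graph G" "simple_graph H" "G \<simeq>\<^sub>g H"
  shows "card (edges G) = card (edges H)"
proof -
  obtain f where f: "bij_betw f (verts G) (verts H)"
      "\<forall>u\<in>verts G. \<forall>v\<in>verts G. {u, v} \<in> edges G \<longleftrightarrow> {f u, f v} \<in> edges H"
    using assms(3) by (auto simp: graph_iso_def)
  have "edges G \<subseteq> Pow (verts G)"
    using assms(1) by (auto simp: simple_graph_def)
  then have "inj_on ((`) f) (edges G)"
    using f(1) by (meson bij_betw_def inj_on_image_Pow inj_on_subset)
  then show ?thesis
    using graph_iso_edges[OF assms(1,2) f] by (simp add: card_image)
qed

text \<open>Transporting \<open>G\<close> along a bijection lets its missing edges be read off on \<open>{..<n}\<close>.\<close>

lemma graph_iso_image: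
  assumes "simple_graph G" "bij_betw f (verts G) W"
  shows "G \<simeq>\<^sub>g (W, (`) f ` edges G)" "(`) f ` edges G \<subseteq> pairs W"
    "card ((`) f ` edges G) = card (edges G)"
proof -
  have inj: "inj_on ((`) f) (Pow (verts G))"
    using assms(2) by (simp add: bij_betw_def inj_on_image_Pow)
  have sub: "edges G \<subseteq> Pow (verts G)"
    using assms(1) by (auto simp: simple_graph_def)
  have "{u, v} \<in> edges G \<longleftrightarrow> {f u, f v} \<in> (`) f ` edges G"
    if "u \<in> verts G" "v \<in> verts G" for u v
    using inj_on_image_mem_iff[OF inj, of "{u, v}" "edges G"] that sub by auto
  then show "G \<simeq>\<^sub>g (W, (`) f ` edges G)"
    unfolding graph_iso_def using assms(2) by auto
  show "(`) f ` edges G \<subseteq> pairs W"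
  proof
    fix e assume "e \<in> (`) f ` edges G"
    then obtain e' where e': "e' \<in> edges G" "e = f ` e'"
      by blast
    then have "e' \<subseteq> verts G" "card e' = 2"
      using assms(1) by (auto simp: simple_graph_def)
    moreover have "inj_on f e'"
      using \<open>e' \<subseteq> verts G\<close> assms(2) by (meson bij_betw_def inj_on_subset)
    ultimately show "e \<in> pairs W"
      using e' assms(2) by (auto simp: pairs_def card_image bij_betw_def)
  qed
  show "card ((`) f ` edges G) = card (edges G)"
    using inj sub by (meson card_image inj_on_subset)
qed

text \<open>After relabelling, any graph is the complete graph minus its missing edges, so only
  their number matters. This settles the equality cases in which every choice of \<open>m\<close>
  edges is extremal; the bound on \<open>m\<close> keeps the subtraction exact.\<close>

lemma card_edges_eq_iff_iso_delete:
  assumes "simple_graph G" "card (verts G) = n" "m \<le> n choose 2"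
  shows "card (edges G) = (n choose 2) - m \<longleftrightarrow>
    (\<exists>M \<subseteq> edges (complete_graph n). card M = m \<and> G \<simeq>\<^sub>g delete_edges (complete_graph n) M)"
    (is "?L \<longleftrightarrow> ?R")
proof
  assume L: ?L
  obtain f where "bij_betw f (verts G) {..<n}"
    using assms(1,2) ex_bij_betw_finite_nat[of "verts G"] atLeast0LessThan
    by (auto simp: simple_graph_def)
  note f = graph_iso_image[OF assms(1) this]
  let ?M = "pairs {..<n} - (`) f ` edges G"
  have "card ?M = m"
    using f L assms(3) finite_subset[OF f(2)]
    by (simp add: card_Diff_subset card_pairs finite_pairs)
  moreover have "delete_edges (complete_graph n) ?M = ({..<n}, (`) f ` edges G)"
    using f(2) by (auto simp: delete_edges_def edges_complete_graph verts_complete_graph)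
  ultimately show ?R
    using f(1) by (intro exI[of _ ?M]) (auto simp: edges_complete_graph)
next
  assume ?R
  then obtain M where M: "M \<subseteq> pairs {..<n}" "card M = m"
    "G \<simeq>\<^sub>g delete_edges (complete_graph n) M"
    by (auto simp: edges_complete_graph)
  have "simple_graph (delete_edges (complete_graph n) M)"
    by (auto simp: simple_graph_def delete_edges_def complete_graph_def)
  then have "card (edges G) = card (edges (delete_edges (complete_graph n) M))"
    using graph_iso_card_edges assms(1) M(3) by blast
  also have "\<dots> = (n choose 2) - m"
    using M finite_subset[OF M(1)]
    by (simp add: delete_edges_def edges_complete_graph card_Diff_subset card_pairs finite_pairs)
  finally show ?L .
qed

lemma extremal_class_edges:
  assumes "H \<in> extremal_class n l" "1 \<le> n"
  shows "simple_graph H" "card (edges H) = ((n - 1) choose 2) + l"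
proof -
  obtain A where A: "A \<subseteq> {..<n - 1}" "card A = l"
    and H: "H = add_vertex (complete_graph (n - 1)) (n - 1) A"
    using assms(1) by (auto simp: extremal_class_def verts_complete_graph)
  have V: "verts H = {..<n}"
    using assms(2) by (auto simp: H add_vertex_def verts_complete_graph)
  have E: "edges H = pairs {..<n - 1} \<union> star (n - 1) A"
    by (auto simp: H add_vertex_def edges_complete_graph star_def)
  have "star (n - 1) A \<subseteq> pairs {..<n}"
    using A assms(2) by (intro star_subset_pairs) auto
  moreover have "pairs {..<n - 1} \<subseteq> pairs {..<n}"
    by (intro pairs_mono) auto
  ultimately show "simple_graph H"
    using V E by (auto simp: simple_graph_def pairs_def)
  have "pairs {..<n - 1} \<inter> star (n - 1) A = {}"
    by (auto simp: pairs_def star_def)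
  then show "card (edges H) = ((n - 1) choose 2) + l"
    using A finite_subset[OF A(1)]
    by (subst E, subst card_Un_disjoint) (auto simp: card_star card_pairs finite_pairs finite_star)
qed

text \<open>Since \<open>v\<close> meets every missing edge, the other vertices form a complete
  graph. Sending \<open>v\<close> to the label \<open>n - 1\<close> yields the required shape, and
  the edge count forces \<open>v\<close> to have \<open>l\<close> neighbours.\<close>

lemma iso_extremal_class:
  assumes G: "simple_graph G" "card (verts G) = n" and n: "1 \<le> n"
    and v: "v \<in> verts G" and missing: "\<forall>e \<in> pairs (verts G) - edges G. v \<in> e"
    and card: "card (edges G) = ((n - 1) choose 2) + l"
  shows "\<exists>H \<in> extremal_class n l. G \<simeq>\<^sub>g H"
proof -
  have "finite (verts G)"
    using G by (simp add: simple_graph_def)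
  then obtain g where g: "bij_betw g (verts G - {v}) {..<n - 1}"
    using ex_bij_betw_finite_nat[of "verts G - {v}"] G v atLeast0LessThan by auto
  define f where "f = g(v := n - 1)"
  have "bij_betw f (verts G - {v}) {..<n - 1} = bij_betw g (verts G - {v}) {..<n - 1}"
    unfolding f_def by (intro bij_betw_cong) auto
  moreover have "bij_betw f {v} {n - 1}"
    by (simp add: f_def)
  ultimately have "bij_betw f (verts G - {v} \<union> {v}) ({..<n - 1} \<union> {n - 1})"
    using g by (intro bij_betw_combine) auto
  moreover have "{..<n - 1} \<union> {n - 1} = {..<n}" "verts G - {v} \<union> {v} = verts G"
    using n v by auto
  ultimately have f: "bij_betw f (verts G) {..<n}"
    by simp
  have fv: "f v = n - 1"
    by (simp add: f_def)
  define E where "E = (`) f ` edges G"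
  note im = graph_iso_image[OF G(1) f, folded E_def]
  define A where "A = {a \<in> {..<n - 1}. {n - 1, a} \<in> E}"
  have "pairs {..<n - 1} \<subseteq> E"
  proof
    fix e assume e: "e \<in> pairs {..<n - 1}"
    then obtain a b where ab: "e = {a, b}" "a < n - 1" "b < n - 1" "a \<noteq> b"
      by (metis pairsE lessThan_iff)
    then have "a \<in> f ` verts G" "b \<in> f ` verts G"
      using f by (auto simp: bij_betw_def)
    then obtain x y where xy: "x \<in> verts G" "y \<in> verts G" "a = f x" "b = f y"
      by blast
    then have "{x, y} \<in> pairs (verts G)" "v \<notin> {x, y}"
      using ab fv by (auto simp: pair_in_pairs)
    then have "{x, y} \<in> edges G"
      using missing by (metis DiffI)
    then show "e \<in> E"
      unfolding E_def using xy ab by (intro image_eqI[of _ _ "{x, y}"]) auto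
  qed
  moreover have "{e \<in> E. n - 1 \<in> e} = star (n - 1) A"
  proof -
    have "{..<n} - {n - 1} = {..<n - 1}"
      using n by auto
    then show ?thesis
      using incident_eq_star[OF im(2), of "n - 1"] by (simp add: A_def)
  qed
  moreover have "{e \<in> E. n - 1 \<notin> e} \<subseteq> pairs {..<n - 1}"
  proof -
    have "{..<n - 1} = {..<n} - {n - 1}"
      using n by auto
    moreover have "{e \<in> pairs {..<n}. n - 1 \<notin> e} \<subseteq> pairs ({..<n} - {n - 1})"
      by (auto simp: pairs_def)
    ultimately show ?thesis
      using im(2) by auto
  qed
  ultimately have E_eq: "E = pairs {..<n - 1} \<union> star (n - 1) A"
    by blast
  have "({..<n}, E) = add_vertex (complete_graph (n - 1)) (n - 1) A"
    unfolding E_eq using n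
    by (auto simp: add_vertex_def edges_complete_graph verts_complete_graph star_def)
  moreover have "card A = l"
  proof -
    have "pairs {..<n - 1} \<inter> star (n - 1) A = {}"
      by (auto simp: pairs_def star_def)
    then have "card E = ((n - 1) choose 2) + card A"
      by (subst E_eq, subst card_Un_disjoint)
        (auto simp: card_star card_pairs finite_pairs finite_star A_def)
    then show ?thesis
      using im(3) card by simp
  qed
  moreover have "A \<subseteq> verts (complete_graph (n - 1))"
    by (auto simp: A_def verts_complete_graph)
  ultimately show ?thesis
    using im(1) unfolding extremal_class_def by blast
qed

section \<open>The edge bounds and the extremal graphs\<close>

theorem theorem2:
  fixes G :: "'a ugraph" and n l :: nat
  assumes "simple_graph G" and "connected_graph G"
    and "card (verts G) = n" and "n \<ge> 6"
    and "1 \<le> l" and "l \<le> n div 2"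
    and "max_tree_conn n G \<le> l"
  shows
    "(1 \<le> l \<and> l \<le> (n - 4) div 2 \<longrightarrow>
        card (edges G) \<le> ((n - 1) choose 2) + l \<and>
        (card (edges G) = ((n - 1) choose 2) + l \<longleftrightarrow>
          (\<exists>H \<in> extremal_class n l. G \<simeq>\<^sub>g H))) \<and>
     (l = (n - 2) div 2 \<and> even n \<longrightarrow>
        card (edges G) \<le> ((n - 1) choose 2) + (n - 2) \<and>
        (card (edges G) = ((n - 1) choose 2) + (n - 2) \<longleftrightarrow>
          (\<exists>e \<in> edges (complete_graph n). G \<simeq>\<^sub>g delete_edges (complete_graph n) {e}))) \<and>
     (l = (n - 2) div 2 \<and> odd n \<longrightarrow>
        card (edges G) \<le> ((n - 1) choose 2) + (n - 3) div 2 \<and>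
        (card (edges G) = ((n - 1) choose 2) + (n - 3) div 2 \<longleftrightarrow>
          (\<exists>M \<subseteq> edges (complete_graph n). card M = (n + 1) div 2 \<and>
             G \<simeq>\<^sub>g delete_edges (complete_graph n) M))) \<and>
     (l = n div 2 \<longrightarrow>
        card (edges G) \<le> n choose 2 \<and>
        (card (edges G) = n choose 2 \<longleftrightarrow> G \<simeq>\<^sub>g complete_graph n))"
proof -
  let ?H = "pairs (verts G) - edges G"
  have fV: "finite (verts G)"
    using assms(1) by (simp add: simple_graph_def)
  note EV = simple_graph_edges[OF assms(1)]
  have fE: "finite (edges G)"
    using finite_subset[OF EV finite_pairs[OF fV]] .
  have "card (edges G) \<le> card (pairs (verts G))"
    using EV finite_pairs[OF fV] by (intro card_mono)
  then have eH: "card (edges G) + card ?H = n choose 2"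
    using fE EV assms(3) card_pairs[OF fV] by (simp add: card_Diff_subset)
  have E: "pairs (verts G) - ?H = edges G"
    using EV by blast
  have np: "\<not> packs (verts G) (edges G) (l + 1)"
    using packs_imp_max_tree_conn_ge[OF assms(1,3)] assms(4,7) by fastforce
  have ch: "n choose 2 = ((n - 1) choose 2) + (n - 1)"
    using assms(4) by (cases n) (auto simp: numeral_2_eq_2)
  note del = card_edges_eq_iff_iso_delete[OF assms(1,3)]
  \<comment> \<open>\<open>packs_few_missing\<close> with \<open>k = l + 1\<close>, read
    contrapositively: at least \<open>n - 1 - l\<close> edges are missing, which by
    \<open>eH\<close> and \<open>ch\<close> leaves at most
    \<open>((n - 1) choose 2) + l\<close>.\<close>
  have few: "n \<le> card ?H + l + 1" if "2 * l + 3 \<le> n"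
  proof (rule ccontr)
    assume "\<not> ?thesis"
    then have "packs (verts G) (pairs (verts G) - ?H) (l + 1)"
      using that fV assms(3) by (intro packs_few_missing) auto
    then show False
      using np E by simp
  qed
  show ?thesis
  proof (intro conjI impI)
    assume l: "1 \<le> l \<and> l \<le> (n - 4) div 2"
    then have n: "2 * l + 4 \<le> n"
      using assms(4) by auto
    then show "card (edges G) \<le> ((n - 1) choose 2) + l"
      using few eH ch by simp
    show "card (edges G) = ((n - 1) choose 2) + l \<longleftrightarrow> (\<exists>H \<in> extremal_class n l. G \<simeq>\<^sub>g H)"
    proof
      assume c: "card (edges G) = ((n - 1) choose 2) + l"
      \<comment> \<open>Equality means \<open>card ?H + (l + 1) = n\<close>, the situation of
        \<open>packs_or_star\<close>; as \<open>l + 1\<close> trees are excluded, one vertex must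
        meet all missing edges.\<close>
      have "\<exists>v\<in>verts G. {e \<in> ?H. v \<in> e} = ?H"
      proof (rule ccontr)
        assume "\<not> ?thesis"
        then have "packs (verts G) (pairs (verts G) - ?H) (l + 1)"
          using fV assms(3) n c eH ch by (intro packs_or_star) auto
        then show False
          using np E by simp
      qed
      then obtain v where "v \<in> verts G" "\<forall>e\<in>?H. v \<in> e"
        by blast
      then show "\<exists>H \<in> extremal_class n l. G \<simeq>\<^sub>g H"
        using iso_extremal_class[OF assms(1,3)] assms(4) c by simp
    next
      assume "\<exists>H \<in> extremal_class n l. G \<simeq>\<^sub>g H"
      then obtain H where H: "H \<in> extremal_class n l" "G \<simeq>\<^sub>g H"
        by blast
      then show "card (edges G) = ((n - 1) choose 2) + l"
        using graph_iso_card_edges[OF assms(1) _ H(2)] extremal_class_edges[OF H(1)] assms(4)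
        by simp
    qed
  next
    assume l: "l = (n - 2) div 2 \<and> even n"
    then have n: "n = 2 * (l + 1)"
      using assms(4) by auto
    \<comment> \<open>Here \<open>n = 2 * (l + 1)\<close>, so the complete graph would have
      \<open>l + 1\<close> trees by \<open>packs_even\<close>.\<close>
    have "?H \<noteq> {}"
    proof
      assume "?H = {}"
      then have "edges G = pairs (verts G)"
        using EV by blast
      then have "packs (verts G) (edges G) (l + 1)"
        using packs_even[OF fV, of "l + 1"] assms(3) n by simp
      then show False
        using np by simp
    qed
    then have "1 \<le> card ?H"
      using finite_pairs[OF fV] by (simp add: Suc_le_eq card_gt_0_iff)
    then show "card (edges G) \<le> ((n - 1) choose 2) + (n - 2)"
      using eH ch assms(4) by simp
    have "((n - 1) choose 2) + (n - 2) = (n choose 2) - 1"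
      using ch assms(4) by simp
    then show "card (edges G) = ((n - 1) choose 2) + (n - 2) \<longleftrightarrow>
        (\<exists>e \<in> edges (complete_graph n). G \<simeq>\<^sub>g delete_edges (complete_graph n) {e})"
      using del[of 1] ch assms(4) by (auto simp: card_1_singleton_iff)
  next
    assume l: "l = (n - 2) div 2 \<and> odd n"
    then have n: "n = 2 * l + 3"
      using assms(4) by (auto elim!: oddE)
    then show "card (edges G) \<le> ((n - 1) choose 2) + (n - 3) div 2"
      using few eH ch by simp
    \<comment> \<open>With \<open>n = 2 * l + 3\<close> the offset \<open>(n - 3) div 2\<close> is
      \<open>l\<close>, and the least number of missing edges \<open>n - 1 - l\<close> is
      \<open>(n + 1) div 2\<close>.\<close>
    have eq: "((n - 1) choose 2) + (n - 3) div 2 = (n choose 2) - (n + 1) div 2"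
      using ch n by simp
    have "(n + 1) div 2 \<le> n choose 2"
      using ch n by simp
    then show "card (edges G) = ((n - 1) choose 2) + (n - 3) div 2 \<longleftrightarrow>
        (\<exists>M \<subseteq> edges (complete_graph n). card M = (n + 1) div 2 \<and>
           G \<simeq>\<^sub>g delete_edges (complete_graph n) M)"
      unfolding eq by (rule del)
  next
    show "card (edges G) \<le> n choose 2"
      using eH by simp
    \<comment> \<open>The bound is trivial here; equality is the case \<open>m = 0\<close> of
      \<open>del\<close>, where the deleted set is empty.\<close>
    have "finite (edges (complete_graph n))"
      by (simp add: edges_complete_graph finite_pairs)
    then have "card M = 0 \<longleftrightarrow> M = {}" if "M \<subseteq> edges (complete_graph n)" for M
      using that by (metis card_0_eq finite_subset)
    moreover have "delete_edges (complete_graph n) {} = complete_graph n"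
      by (simp add: delete_edges_def)
    ultimately show "card (edges G) = n choose 2 \<longleftrightarrow> G \<simeq>\<^sub>g complete_graph n"
      using del[of 0] by (metis diff_zero empty_subsetI zero_le)
  qed
qed

end
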